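(* Let $T$ be an irreducible transition matrix on a finite state space $\mathbb{X}$ with Poincaré constant $\gamma$. For every density $f\in\mathcal{F}_1^+$ and every $\varepsilon\in(0,1/2)$, $$\mathrm{w}_{\mathrm{mix}}(f,\varepsilon)\ \le\ \frac{2}{\gamma\varepsilon^2}\left(1+\sqrt{V_{f,\varepsilon}}\right),$$ where $V_{f,\varepsilon}:=\mathrm{Varent}(P_t^\star f)$ is the varentropy at time $t=\mathrm{t}_{\mathrm{mix}}(f,1-\varepsilon)$. Similarly, for every $\varepsilon\in(0,1/2)$, $$\mathrm{w}_{\mathrm{mix}}(\varepsilon)\ \le\ \frac{2}{\gamma\varepsilon^2}\left(1+\sqrt{V_{\varepsilon}}\right),$$ where $V_\varepsilon:=\max_{x\in\mathbb{X}}\mathrm{Varent}(P_t^\star f^x)$ is the worst-case varentropy at time $t=\mathrm{t}_{\mathrm{mix}}(1-\varepsilon)$.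
   Context: $\mathbb{X}$ is a finite set with at least two elements and $T$ is an irreducible stochastic matrix on $\mathbb{X}$ (for all $x,y$ there is $k\ge 0$ with $T^k(x,y)>0$), with unique stationary law $\pi$ ($\pi T=\pi$), which has full support. Matrices act on functions by $(Af)(x)=\sum_y A(x,y)f(y)$. Set $L=T-\mathrm{Id}$, $P_t=e^{tL}$, $T^\star(x,y)=\pi(y)T(y,x)/\pi(x)$, $P_t^\star=e^{t(T^\star-\mathrm{Id})}$. Write $\mathbf{E}[f]=\sum_x\pi(x)f(x)$. $\mathcal{F}_1^+$ is the set of densities: functions $f:\mathbb{X}\to[0,\infty)$ with $\mathbf{E}[f]=1$; $f^x=\mathbf{1}_{\{x\}}/\pi(x)$ is the Dirac density at $x$. If $X_0$ has density $f$ w.r.t. $\pi$, then $P_t^\star f$ is the density at time $t$ of the continuous-time chain with generator $L$. Total variation: $\mathrm{TV}(f)=\frac12\mathbf{E}[|f-1|]$. Mixing times: $\mathrm{t}_{\mathrm{mix}}(f,\varepsilon)=\min\{t\ge0:\mathrm{TV}(P_t^\star f)\le\varepsilon\}$ and $\mathrm{t}_{\mathrm{mix}}(\varepsilon)=\max_{x\in\mathbb{X}}\mathrm{t}_{\mathrm{mix}}(f^x,\varepsilon)$. Widths: $\mathrm{w}_{\mathrm{mix}}(f,\varepsilon)=\mathrm{t}_{\mathrm{mix}}(f,\varepsilon)-\mathrm{t}_{\mathrm{mix}}(f,1-\varepsilon)$ and $\mathrm{w}_{\mathrm{mix}}(\varepsilon)=\mathrm{t}_{\mathrm{mix}}(\varepsilon)-\mathrm{t}_{\mathrm{mix}}(1-\varepsilon)$.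 Varentropy: for $f\in\mathcal{F}_1^+$, $\mathrm{Varent}(f)=\mathrm{Var}[\log f(X)]$ where $X$ is a random variable with density $f$ w.r.t. $\pi$. Poincaré constant: $\gamma$ is the largest constant such that $\mathbf{E}[f\cdot(-Lf)]\ge\gamma\,(\mathbf{E}[f^2]-\mathbf{E}[f]^2)$ for all $f:\mathbb{X}\to\mathbb{R}$. *)

theory Defs
  imports "HOL-Analysis.Analysis"
begin

text \<open>
  The state space is the finite type \<open>'a\<close>; functions and laws on it are vectors
  \<open>real ^ 'a\<close>, and \<open>A $ x $ y\<close> is the matrix entry \<open>A(x,y)\<close>, so that the action
  of \<open>A\<close> on a function \<open>f\<close> is \<open>A *v f\<close>.
\<close>

text \<open>Powers and exponentials are defined here because the library's power on
  \<^typ>\<open>real ^ 'a ^ 'a\<close> is the entrywise one.\<close>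

primrec matrix_pow :: "real ^ 'a ^ 'a \<Rightarrow> nat \<Rightarrow> real ^ 'a ^ 'a" where
  "matrix_pow A 0 = mat 1"
| "matrix_pow A (Suc k) = A ** matrix_pow A k"

definition matrix_exp :: "real ^ 'a ^ 'a \<Rightarrow> real ^ 'a ^ 'a" where
  "matrix_exp A = (\<Sum>k. (1 / fact k) *\<^sub>R matrix_pow A k)"

definition stochastic_matrix :: "real ^ 'a ^ 'a \<Rightarrow> bool" where
  "stochastic_matrix T \<longleftrightarrow> (\<forall>x y. 0 \<le> T $ x $ y) \<and> (\<forall>x. (\<Sum>y\<in>UNIV. T $ x $ y) = 1)"

definition irreducible_matrix :: "real ^ 'a ^ 'a \<Rightarrow> bool" where
  "irreducible_matrix T \<longleftrightarrow> (\<forall>x y. \<exists>k. 0 < matrix_pow T k $ x $ y)"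

definition stationary_law :: "real ^ 'a ^ 'a \<Rightarrow> real ^ 'a \<Rightarrow> bool" where
  "stationary_law T \<pi> \<longleftrightarrow>
     (\<forall>x. 0 \<le> \<pi> $ x) \<and> (\<Sum>x\<in>UNIV. \<pi> $ x) = 1 \<and> \<pi> v* T = \<pi>"

definition expect :: "real ^ 'a \<Rightarrow> ('a \<Rightarrow> real) \<Rightarrow> real" where
  "expect \<pi> g = (\<Sum>x\<in>UNIV. \<pi> $ x * g x)"

definition generator :: "real ^ 'a ^ 'a \<Rightarrow> real ^ 'a ^ 'a" where
  "generator T = T - mat 1"

definition time_reversal :: "real ^ 'a \<Rightarrow> real ^ 'a ^ 'a \<Rightarrow> real ^ 'a ^ 'a" where
  "time_reversal \<pi> T = (\<chi> x y. \<pi> $ y * T $ y $ x / \<pi> $ x)"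

definition semigroup_star :: "real ^ 'a ^ 'a \<Rightarrow> real ^ 'a \<Rightarrow> real \<Rightarrow> real ^ 'a ^ 'a" where
  "semigroup_star T \<pi> t = matrix_exp (t *\<^sub>R generator (time_reversal \<pi> T))"

definition densities :: "real ^ 'a \<Rightarrow> (real ^ 'a) set" where
  "densities \<pi> = {f. (\<forall>x. 0 \<le> f $ x) \<and> expect \<pi> (\<lambda>x. f $ x) = 1}"

definition dirac_density :: "real ^ 'a \<Rightarrow> 'a \<Rightarrow> real ^ 'a" where
  "dirac_density \<pi> x = (\<chi> y. if y = x then 1 / \<pi> $ x else 0)"

definition tv :: "real ^ 'a \<Rightarrow> real ^ 'a \<Rightarrow> real" where
  "tv \<pi> f = 1 / 2 * expect \<pi> (\<lambda>x. \<bar>f $ x - 1\<bar>)"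

definition tmix_from :: "real ^ 'a ^ 'a \<Rightarrow> real ^ 'a \<Rightarrow> real ^ 'a \<Rightarrow> real \<Rightarrow> real" where
  "tmix_from T \<pi> f \<epsilon> = (LEAST t. 0 \<le> t \<and> tv \<pi> (semigroup_star T \<pi> t *v f) \<le> \<epsilon>)"

definition tmix :: "real ^ 'a ^ 'a \<Rightarrow> real ^ 'a \<Rightarrow> real \<Rightarrow> real" where
  "tmix T \<pi> \<epsilon> = (MAX x. tmix_from T \<pi> (dirac_density \<pi> x) \<epsilon>)"

definition wmix_from :: "real ^ 'a ^ 'a \<Rightarrow> real ^ 'a \<Rightarrow> real ^ 'a \<Rightarrow> real \<Rightarrow> real" where
  "wmix_from T \<pi> f \<epsilon> = tmix_from T \<pi> f \<epsilon> - tmix_from T \<pi> f (1 - \<epsilon>)"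

definition wmix :: "real ^ 'a ^ 'a \<Rightarrow> real ^ 'a \<Rightarrow> real \<Rightarrow> real" where
  "wmix T \<pi> \<epsilon> = tmix T \<pi> \<epsilon> - tmix T \<pi> (1 - \<epsilon>)"

text \<open>If \<open>X\<close> has density \<open>f\<close> with respect to \<open>\<pi>\<close>, the mean of \<open>g(X)\<close> is
  the \<open>\<pi>\<close>-mean of \<open>f g\<close>; below this is used for the variance of \<open>g(X)\<close> with
  \<open>g = ln f\<close>. Points where \<open>f\<close> vanishes are not charged by the law of \<open>X\<close>, so
  the value of \<^term>\<open>ln (0::real)\<close> is irrelevant.\<close>

definition varent :: "real ^ 'a \<Rightarrow> real ^ 'a \<Rightarrow> real" where
  "varent \<pi> f =
     expect \<pi> (\<lambda>x. f $ x * (ln (f $ x) - expect \<pi> (\<lambda>y. f $ y * ln (f $ y)))\<^sup>2)"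

definition poincare_constant :: "real ^ 'a ^ 'a \<Rightarrow> real ^ 'a \<Rightarrow> real" where
  "poincare_constant T \<pi> =
     (GREATEST \<gamma>. \<forall>f :: real ^ 'a.
        expect \<pi> (\<lambda>x. f $ x * (- (generator T *v f)) $ x)
          \<ge> \<gamma> * (expect \<pi> (\<lambda>x. (f $ x)\<^sup>2) - (expect \<pi> (\<lambda>x. f $ x))\<^sup>2))"

end

theory Submission
  imports Defs
begin

text \<open>
  Write \<open>g = P\<^sup>\<star>\<^sub>t f\<close> for the density at a time \<open>t\<close> at which the total variation
  distance is only known to be at most \<open>1 - \<epsilon>\<close>. The point is that the varentropy
  \<open>V\<close> of \<open>g\<close> turns this very weak information into a bound on the size of \<open>g\<close>.

  Let \<open>H\<close> be the mean of \<open>ln g\<close> under the law with density \<open>g\<close>, so that \<open>V\<close> is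
  the variance of \<open>ln g\<close> under that law. Since the distance to equilibrium is at
  most \<open>1 - \<epsilon>\<close>, the event \<open>g < 2 / \<epsilon>\<close> has mass at least \<open>\<epsilon> / 2\<close>
  (\<open>mass_below_ge\<close>). Were \<open>H\<close> much larger than \<open>ln (2 / \<epsilon>)\<close>, this event would
  contradict Chebyshev's inequality; hence \<open>H \<le> ln (2 / \<epsilon>) + sqrt (2 V / \<epsilon>)\<close>
  (\<open>relative_entropy_le\<close>). Chebyshev's inequality for the upper tail then shows
  that \<open>g\<close> exceeds \<open>exp (H + s)\<close>, where \<open>s = sqrt (2 V / \<epsilon>) + 1\<close>, only
  on an event of mass at most \<open>\<epsilon> / 2\<close>.

  Cut \<open>g\<close> at this level. The upper part stays of mass at most \<open>\<epsilon> / 2\<close> under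
  the semigroup, which contracts \<open>L\<^sup>1\<close>. The lower part has second moment at most
  \<open>exp (H + s)\<close>, and its variance decays at rate \<open>2 \<gamma>\<close> by the Poincare inequality,
  so after a further time of order \<open>(H + s + ln (1 / \<epsilon>)) / \<gamma>\<close> it is within
  \<open>\<epsilon> / 2\<close> of equilibrium (\<open>tv_P_truncation\<close>, \<open>tv_P_le_of_varent\<close>). This time
  is below \<open>2 / (\<gamma> \<epsilon>\<^sup>2) * (1 + sqrt V)\<close>. The argument works from any time \<open>t\<close>
  with distance at most \<open>1 - \<epsilon>\<close>; for the worst-case statement \<open>t\<close> is the maximum of
  the mixing times over Dirac starts, which is late enough for every start because
  the distance decreases in time.

  The rest makes these tools available: the exponential of a matrix as the unique
  solution of a linear differential equation, which yields the semigroup law,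
  positivity and the decay of the variance; and the fact that the largest constant
  in the Poincare inequality exists and is positive for an irreducible chain.
\<close>

section \<open>The matrix exponential\<close>

lemma sums_vecI:
  fixes f :: "nat \<Rightarrow> 'b::real_normed_vector ^ 'n"
  assumes "\<And>i. (\<lambda>k. f k $ i) sums (s $ i)"
  shows "f sums s"
  using assms unfolding sums_def by (intro vec_tendstoI) simp

lemma matrix_pow_scaleR: "matrix_pow (t *\<^sub>R A) k = t ^ k *\<^sub>R matrix_pow A k"
  by (induction k) (simp_all add: matrix_matrix_mult_def vec_eq_iff sum_distrib_left mult_ac)

lemma matrix_pow_commute: "matrix_pow A k ** A = A ** matrix_pow A k"
  by (induction k) (simp_all add: matrix_mul_assoc [symmetric])

text \<open>Geometric growth of the entries, however crude the base, makes each entry of the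
  exponential an everywhere convergent power series in time.\<close>

lemma abs_matrix_pow_le:
  fixes A :: "real ^ 'a ^ 'a"
  shows "\<bar>matrix_pow A k $ x $ y\<bar> \<le> (\<Sum>x\<in>UNIV. \<Sum>y\<in>UNIV. \<bar>A $ x $ y\<bar>) ^ k"
proof (induction k arbitrary: x y)
  case 0
  show ?case by (simp add: mat_def)
next
  case (Suc k)
  let ?C = "\<Sum>x\<in>UNIV. \<Sum>y\<in>UNIV. \<bar>A $ x $ y\<bar>"
  have "\<bar>matrix_pow A (Suc k) $ x $ y\<bar> \<le> (\<Sum>z\<in>UNIV. \<bar>A $ x $ z * matrix_pow A k $ z $ y\<bar>)"
    by (simp add: matrix_matrix_mult_def sum_abs)
  also have "\<dots> \<le> (\<Sum>z\<in>UNIV. \<bar>A $ x $ z\<bar> * ?C ^ k)"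
    by (intro sum_mono) (simp add: abs_mult Suc.IH mult_left_mono)
  also have "\<dots> = (\<Sum>z\<in>UNIV. \<bar>A $ x $ z\<bar>) * ?C ^ k"
    by (simp add: sum_distrib_right)
  also have "\<dots> \<le> ?C * ?C ^ k"
    by (intro mult_right_mono member_le_sum zero_le_power sum_nonneg) auto
  finally show ?case by simp
qed

lemma summable_matrix_exp_entry:
  fixes A :: "real ^ 'a ^ 'a"
  shows "summable (\<lambda>k. (matrix_pow A k $ x $ y / fact k) * t ^ k)"
proof (rule summable_comparison_test', rule summable_exp)
  fix k :: nat
  let ?C = "\<Sum>x\<in>UNIV. \<Sum>y\<in>UNIV. \<bar>A $ x $ y\<bar>"
  have "\<bar>matrix_pow A k $ x $ y\<bar> * \<bar>t\<bar> ^ k \<le> ?C ^ k * \<bar>t\<bar> ^ k"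
    by (intro mult_right_mono abs_matrix_pow_le) auto
  then show "norm ((matrix_pow A k $ x $ y / fact k) * t ^ k) \<le> inverse (fact k) * (?C * \<bar>t\<bar>) ^ k"
    by (simp add: abs_mult power_abs power_mult_distrib field_simps)
qed

lemma matrix_exp_entry_sums:
  fixes A :: "real ^ 'a ^ 'a"
  shows "(\<lambda>k. (matrix_pow A k $ x $ y / fact k) * t ^ k) sums matrix_exp (t *\<^sub>R A) $ x $ y"
proof -
  define M :: "real ^ 'a ^ 'a"
    where "M = (\<chi> x y. \<Sum>k. (matrix_pow A k $ x $ y / fact k) * t ^ k)"
  have *: "(\<lambda>k. (matrix_pow A k $ x $ y / fact k) * t ^ k) sums M $ x $ y" for x y
    unfolding M_def vec_lambda_beta by (intro summable_sums summable_matrix_exp_entry)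
  have "(\<lambda>k. (1 / fact k) *\<^sub>R matrix_pow (t *\<^sub>R A) k) sums M"
    using * by (intro sums_vecI) (simp add: matrix_pow_scaleR mult_ac)
  then show ?thesis
    using * by (simp add: matrix_exp_def sums_unique [symmetric])
qed

lemma matrix_exp_0: "matrix_exp (0 :: real ^ 'a ^ 'a) = mat 1"
proof -
  have "matrix_exp (0 *\<^sub>R (0 :: real ^ 'a ^ 'a)) $ x $ y = mat 1 $ x $ y" for x y
    using sums_unique2 [OF matrix_exp_entry_sums [where t = 0] powser_sums_zero]
    by simp
  then show ?thesis by (simp add: vec_eq_iff)
qed

lemma matrix_exp_mult_entry_sums:
  fixes A :: "real ^ 'a ^ 'a"
  shows "(\<lambda>k. ((A ** matrix_pow A k) $ x $ y / fact k) * t ^ k) sums (A ** matrix_exp (t *\<^sub>R A)) $ x $ y"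
proof -
  have "(\<lambda>k. \<Sum>z\<in>UNIV. A $ x $ z * ((matrix_pow A k $ z $ y / fact k) * t ^ k))
      sums (\<Sum>z\<in>UNIV. A $ x $ z * matrix_exp (t *\<^sub>R A) $ z $ y)"
    by (intro sums_sum sums_mult matrix_exp_entry_sums)
  then show ?thesis
    by (simp add: matrix_matrix_mult_def sum_divide_distrib sum_distrib_left sum_distrib_right mult_ac)
qed

lemma matrix_exp_commute:
  fixes A :: "real ^ 'a ^ 'a"
  shows "matrix_exp (t *\<^sub>R A) ** A = A ** matrix_exp (t *\<^sub>R A)"
proof -
  have *: "(\<lambda>k. ((matrix_pow A k ** A) $ x $ y / fact k) * t ^ k) sums (matrix_exp (t *\<^sub>R A) ** A) $ x $ y"
    for x y
  proof -
    have "(\<lambda>k. \<Sum>z\<in>UNIV. ((matrix_pow A k $ x $ z / fact k) * t ^ k) * A $ z $ y)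
        sums (\<Sum>z\<in>UNIV. matrix_exp (t *\<^sub>R A) $ x $ z * A $ z $ y)"
      by (intro sums_sum sums_mult2 matrix_exp_entry_sums)
    then show ?thesis
      by (simp add: matrix_matrix_mult_def sum_divide_distrib sum_distrib_left sum_distrib_right mult_ac)
  qed
  show ?thesis
    unfolding vec_eq_iff
    using sums_unique2 [OF * [unfolded matrix_pow_commute] matrix_exp_mult_entry_sums] by blast
qed

text \<open>Entries are real power series, so the derivative is obtained term by term; the
  factor \<open>k + 1\<close> from differentiating cancels in the factorial and leaves one factor
  \<open>A\<close> in front.\<close>

lemma DERIV_matrix_exp:
  fixes A :: "real ^ 'a ^ 'a"
  shows "((\<lambda>t. matrix_exp (t *\<^sub>R A) $ x $ y) has_field_derivative
           (A ** matrix_exp (t *\<^sub>R A)) $ x $ y) (at t)"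
proof -
  define c where "c k = matrix_pow A k $ x $ y / fact k" for k
  have c: "(\<lambda>k. c k * t ^ k) sums matrix_exp (t *\<^sub>R A) $ x $ y" for t
    unfolding c_def by (rule matrix_exp_entry_sums)
  have "diffs c k * t ^ k = ((A ** matrix_pow A k) $ x $ y / fact k) * t ^ k" for k
    by (simp add: diffs_def c_def del: of_nat_Suc)
  then have "(\<Sum>k. diffs c k * t ^ k) = (A ** matrix_exp (t *\<^sub>R A)) $ x $ y"
    using sums_unique [OF matrix_exp_mult_entry_sums [of A x y t]] by simp
  moreover have "((\<lambda>t. \<Sum>k. c k * t ^ k) has_field_derivative (\<Sum>k. diffs c k * t ^ k)) (at t)"
    using c by (intro termdiffs_strong_converges_everywhere) (rule sums_summable)
  ultimately show ?thesis
    using sums_unique [OF c] by simp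
qed

definition solves_linear_ode :: "real ^ 'a ^ 'a \<Rightarrow> (real \<Rightarrow> real ^ 'a) \<Rightarrow> bool" where
  "solves_linear_ode A v \<longleftrightarrow>
     (\<forall>t x. ((\<lambda>t. v t $ x) has_field_derivative (A *v v t) $ x) (at t))"

lemma solves_linear_odeD:
  "solves_linear_ode A v \<Longrightarrow> ((\<lambda>t. v t $ x) has_field_derivative (A *v v t) $ x) (at t)"
  by (simp add: solves_linear_ode_def)

lemma solves_linear_ode_matrix_exp:
  "solves_linear_ode A (\<lambda>t. matrix_exp (t *\<^sub>R A) *v w)"
proof -
  have "((\<lambda>t. \<Sum>y\<in>UNIV. matrix_exp (t *\<^sub>R A) $ x $ y * w $ y) has_field_derivative
          (\<Sum>y\<in>UNIV. (A ** matrix_exp (t *\<^sub>R A)) $ x $ y * w $ y)) (at t)" for x t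
    by (intro DERIV_sum DERIV_cmult_right DERIV_matrix_exp)
  then show ?thesis
    unfolding solves_linear_ode_def matrix_vector_mul_assoc
    by (simp add: matrix_vector_mult_def)
qed

text \<open>The derivative of the left-hand side in \<open>t\<close> is \<open>- e\<^bsup>-tA\<^esup> A v + e\<^bsup>-tA\<^esup> A v = 0\<close>,
  by commutation of \<open>A\<close> with its exponential.\<close>

lemma matrix_exp_minus_solution:
  assumes "solves_linear_ode A v"
  shows "matrix_exp (- t *\<^sub>R A) *v v t = v 0"
proof -
  let ?E = "\<lambda>s. matrix_exp (- s *\<^sub>R A)"
  have "(?E t *v v t) $ x = (?E 0 *v v 0) $ x" for x
  proof -
    have D: "((\<lambda>s. ?E s $ x $ y) has_field_derivative - (?E s ** A) $ x $ y) (at s)" for s y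
      using DERIV_matrix_exp [of A x y "- s"]
      unfolding matrix_exp_commute by (simp only: DERIV_mirror)
    have "((\<lambda>s. \<Sum>y\<in>UNIV. ?E s $ x $ y * v s $ y) has_field_derivative
        (\<Sum>y\<in>UNIV. ?E s $ x $ y * (A *v v s) $ y + - (?E s ** A) $ x $ y * v s $ y)) (at s)" for s
      by (intro DERIV_sum DERIV_mult' D solves_linear_odeD [OF assms])
    moreover have "(\<lambda>s. \<Sum>y\<in>UNIV. ?E s $ x $ y * v s $ y) = (\<lambda>s. (?E s *v v s) $ x)"
      by (simp add: matrix_vector_mult_def)
    moreover have "(\<Sum>y\<in>UNIV. ?E s $ x $ y * (A *v v s) $ y + - (?E s ** A) $ x $ y * v s $ y)
        = (?E s *v (A *v v s)) $ x - ((?E s ** A) *v v s) $ x" for s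
      unfolding matrix_vector_mult_def [of "?E s"] matrix_vector_mult_def [of "?E s ** A"]
      by (simp add: sum_subtractf sum_negf)
    ultimately have "((\<lambda>s. (?E s *v v s) $ x) has_field_derivative 0) (at s)" for s
      by (simp only: matrix_vector_mul_assoc diff_self)
    then show ?thesis
      by (intro DERIV_isconst_all) blast
  qed
  then show ?thesis
    by (simp add: vec_eq_iff matrix_exp_0)
qed

text \<open>Applied to the solution \<open>t \<mapsto> e\<^bsup>tA\<^esup> w\<close>, the previous lemma says that
  \<open>e\<^bsup>-tA\<^esup>\<close> and \<open>e\<^bsup>tA\<^esup>\<close> are inverse to each other; applied to \<open>v\<close>, it then gives uniqueness.
  The algebraic identities for the exponential needed below all follow by checking that
  both sides solve the same equation.\<close>

lemma linear_ode_unique: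
  assumes "solves_linear_ode A v"
  shows "v t = matrix_exp (t *\<^sub>R A) *v v 0"
proof -
  have "matrix_exp (t *\<^sub>R A) *v (matrix_exp (- t *\<^sub>R A) *v v t) = v t"
    using matrix_exp_minus_solution [OF solves_linear_ode_matrix_exp, of "- t" A "v t"]
    by (simp add: matrix_exp_0)
  then show ?thesis
    by (simp only: matrix_exp_minus_solution [OF assms])
qed

lemma matrix_exp_add:
  "matrix_exp ((s + t) *\<^sub>R A) *v w = matrix_exp (s *\<^sub>R A) *v (matrix_exp (t *\<^sub>R A) *v w)"
proof -
  have "solves_linear_ode A (\<lambda>s. matrix_exp ((s + t) *\<^sub>R A) *v w)"
    unfolding solves_linear_ode_def
    by (intro allI DERIV_shift [THEN iffD1] solves_linear_odeD [OF solves_linear_ode_matrix_exp])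
  from linear_ode_unique [OF this] show ?thesis by simp
qed

text \<open>This is how positivity of the semigroup is seen: for stochastic \<open>A\<close> the
  diagonal of \<open>A - Id\<close> is nonpositive, but \<open>A\<close> and hence its exponential are nonnegative.\<close>

lemma matrix_exp_diff_mat_1:
  "matrix_exp (t *\<^sub>R (A - mat 1)) *v w = exp (- t) *\<^sub>R (matrix_exp (t *\<^sub>R A) *v w)"
proof -
  let ?v = "\<lambda>t. exp (- t) *\<^sub>R (matrix_exp (t *\<^sub>R A) *v w)"
  have "((\<lambda>t. ?v t $ x) has_field_derivative ((A - mat 1) *v ?v t) $ x) (at t)" for x t
    unfolding vector_scaleR_component real_scaleR_def
    by (rule derivative_eq_intros solves_linear_odeD [OF solves_linear_ode_matrix_exp] refl)+
      (simp add: matrix_vector_mult_diff_rdistrib matrix_vector_mult_scaleR algebra_simps)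
  then have "solves_linear_ode (A - mat 1) ?v"
    by (simp add: solves_linear_ode_def)
  from linear_ode_unique [OF this, of t] show ?thesis by (simp add: matrix_exp_0)
qed

section \<open>Markov semigroups with a stationary law\<close>

lemma expect_add: "expect \<pi> (\<lambda>x. f x + g x) = expect \<pi> f + expect \<pi> g"
  by (simp add: expect_def sum.distrib algebra_simps)

lemma expect_diff: "expect \<pi> (\<lambda>x. f x - g x) = expect \<pi> f - expect \<pi> g"
  by (simp add: expect_def sum_subtractf algebra_simps)

lemma expect_cmult: "expect \<pi> (\<lambda>x. c * f x) = c * expect \<pi> f"
  by (simp add: expect_def sum_distrib_left mult_ac)

lemma expect_const: "(\<Sum>x\<in>UNIV. \<pi> $ x) = 1 \<Longrightarrow> expect \<pi> (\<lambda>x. c) = c"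
  by (simp add: expect_def flip: sum_distrib_right)

lemma expect_mono:
  assumes "\<And>x. 0 \<le> \<pi> $ x" "\<And>x. f x \<le> g x"
  shows "expect \<pi> f \<le> expect \<pi> g"
  unfolding expect_def using assms by (intro sum_mono mult_left_mono) auto

lemma expect_nonneg:
  assumes "\<And>x. 0 \<le> \<pi> $ x" "\<And>x. 0 \<le> f x"
  shows "0 \<le> expect \<pi> f"
  unfolding expect_def using assms by (intro sum_nonneg) auto

lemma expect_variance:
  assumes "(\<Sum>x\<in>UNIV. \<pi> $ x) = 1"
  shows "expect \<pi> (\<lambda>x. (f x - expect \<pi> f)\<^sup>2) = expect \<pi> (\<lambda>x. (f x)\<^sup>2) - (expect \<pi> f)\<^sup>2"
proof -
  let ?m = "expect \<pi> f"
  have "expect \<pi> (\<lambda>x. (f x - ?m)\<^sup>2) = expect \<pi> (\<lambda>x. ((f x)\<^sup>2 - (2 * ?m) * f x) + ?m\<^sup>2)"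
    by (simp add: power2_eq_square algebra_simps)
  then show ?thesis
    unfolding expect_add expect_diff expect_cmult expect_const [OF assms]
    by (simp add: power2_eq_square)
qed

lemma expect_abs_le_sqrt:
  assumes "\<And>x. 0 \<le> \<pi> $ x" "(\<Sum>x\<in>UNIV. \<pi> $ x) = 1"
  shows "expect \<pi> (\<lambda>x. \<bar>f x\<bar>) \<le> sqrt (expect \<pi> (\<lambda>x. (f x)\<^sup>2))"
proof (rule real_le_rsqrt)
  have "0 \<le> expect \<pi> (\<lambda>x. (\<bar>f x\<bar> - expect \<pi> (\<lambda>x. \<bar>f x\<bar>))\<^sup>2)"
    using assms by (intro expect_nonneg) auto
  then show "(expect \<pi> (\<lambda>x. \<bar>f x\<bar>))\<^sup>2 \<le> expect \<pi> (\<lambda>x. (f x)\<^sup>2)"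
    by (simp add: expect_variance [OF assms(2)])
qed

lemma matrix_pow_nonneg:
  fixes K :: "real ^ 'a ^ 'a"
  assumes "\<And>x y. 0 \<le> K $ x $ y"
  shows "0 \<le> matrix_pow K k $ x $ y"
proof (induction k arbitrary: x y)
  case 0
  show ?case by (simp add: mat_def)
next
  case (Suc k)
  then show ?case using assms by (simp add: matrix_matrix_mult_def sum_nonneg)
qed

lemma matrix_exp_nonneg:
  fixes K :: "real ^ 'a ^ 'a"
  assumes "\<And>x y. 0 \<le> K $ x $ y" "0 \<le> t"
  shows "0 \<le> matrix_exp (t *\<^sub>R K) $ x $ y"
  using sums_le [OF _ sums_zero matrix_exp_entry_sums [of K x y t]] assms
  by (simp add: matrix_pow_nonneg)

text \<open>The locale serves
  both for \<open>T\<close>, which carries the Poincare constant, and for its time reversal, which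
  drives the densities.\<close>

locale stationary_chain =
  fixes K :: "real ^ 'a ^ 'a" and \<pi> :: "real ^ 'a"
  assumes stoch: "stochastic_matrix K" and stat: "stationary_law K \<pi>"
begin

lemma pi_nonneg: "0 \<le> \<pi> $ x" and pi_sum: "(\<Sum>x\<in>UNIV. \<pi> $ x) = 1"
  using stat by (auto simp: stationary_law_def)

lemma pi_stat: "(\<Sum>x\<in>UNIV. \<pi> $ x * K $ x $ y) = \<pi> $ y"
proof -
  have "(\<pi> v* K) $ y = \<pi> $ y" using stat by (simp add: stationary_law_def)
  then show ?thesis by (simp add: vector_matrix_mult_def mult.commute)
qed

lemma K_nonneg: "0 \<le> K $ x $ y" and K_sum: "(\<Sum>y\<in>UNIV. K $ x $ y) = 1"
  using stoch by (auto simp: stochastic_matrix_def)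

definition P :: "real \<Rightarrow> real ^ 'a ^ 'a"
  where "P t = matrix_exp (t *\<^sub>R generator K)"

lemma P_0: "P 0 *v w = w"
  by (simp add: P_def matrix_exp_0)

lemma P_add: "P (s + t) *v w = P s *v (P t *v w)"
  unfolding P_def by (rule matrix_exp_add)

lemma P_DERIV: "((\<lambda>t. (P t *v w) $ x) has_field_derivative (generator K *v (P t *v w)) $ x) (at t)"
  unfolding P_def by (rule solves_linear_odeD [OF solves_linear_ode_matrix_exp])

lemma P_nonneg:
  assumes "0 \<le> t" "\<And>x. 0 \<le> w $ x"
  shows "0 \<le> (P t *v w) $ x"
  unfolding P_def generator_def matrix_exp_diff_mat_1
  using matrix_exp_nonneg [OF K_nonneg assms(1)] assms(2)
  by (simp add: matrix_vector_mult_def sum_nonneg)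

lemma generator_nth: "(generator K *v w) $ x = (K *v w) $ x - w $ x"
  by (simp add: generator_def matrix_vector_mult_diff_rdistrib)

lemma K_const: "K *v (\<chi> x. c) = (\<chi> x. c)"
  by (simp add: matrix_vector_mult_def vec_eq_iff K_sum flip: sum_distrib_right)

lemma P_const: "P t *v (\<chi> x. c) = (\<chi> x. c)"
proof -
  have "solves_linear_ode (generator K) (\<lambda>t. \<chi> x. c)"
    by (simp add: solves_linear_ode_def generator_nth K_const)
  from linear_ode_unique [OF this] show ?thesis by (simp add: P_def)
qed

lemma expect_K: "expect \<pi> (\<lambda>x. (K *v w) $ x) = expect \<pi> (\<lambda>x. w $ x)"
proof -
  have "expect \<pi> (\<lambda>x. (K *v w) $ x) = (\<Sum>x\<in>UNIV. \<Sum>y\<in>UNIV. (\<pi> $ x * K $ x $ y) * w $ y)"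
    by (simp add: expect_def matrix_vector_mult_def sum_distrib_left mult_ac)
  also have "\<dots> = (\<Sum>y\<in>UNIV. (\<Sum>x\<in>UNIV. \<pi> $ x * K $ x $ y) * w $ y)"
    by (subst sum.swap) (simp add: sum_distrib_right)
  finally show ?thesis by (simp add: pi_stat expect_def)
qed

text \<open>The derivative in time vanishes, because the law is stationary.\<close>

lemma expect_P: "expect \<pi> (\<lambda>x. (P t *v w) $ x) = expect \<pi> (\<lambda>x. w $ x)"
proof -
  have "((\<lambda>t. expect \<pi> (\<lambda>x. (P t *v w) $ x)) has_field_derivative
          expect \<pi> (\<lambda>x. (generator K *v (P t *v w)) $ x)) (at t)" for t
    unfolding expect_def by (intro DERIV_sum DERIV_cmult P_DERIV)
  then have "((\<lambda>t. expect \<pi> (\<lambda>x. (P t *v w) $ x)) has_field_derivative 0) (at t)" for t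
    by (simp add: generator_nth expect_diff expect_K)
  then have "expect \<pi> (\<lambda>x. (P t *v w) $ x) = expect \<pi> (\<lambda>x. (P 0 *v w) $ x)"
    by (intro DERIV_isconst_all) blast
  then show ?thesis by (simp add: P_0)
qed

text \<open>Positivity gives \<open>\<bar>P\<^sub>t w\<bar> \<le> P\<^sub>t \<bar>w\<bar>\<close>, and \<open>P\<^sub>t\<close> preserves means.\<close>

lemma expect_abs_P_le:
  assumes "0 \<le> t"
  shows "expect \<pi> (\<lambda>x. \<bar>(P t *v w) $ x\<bar>) \<le> expect \<pi> (\<lambda>x. \<bar>w $ x\<bar>)"
proof -
  let ?a = "\<chi> x. \<bar>w $ x\<bar>"
  have "\<bar>(P t *v w) $ x\<bar> \<le> (P t *v ?a) $ x" for x
  proof -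
    have "0 \<le> (?a - w) $ x" "0 \<le> (?a + w) $ x" for x
      using abs_ge_minus_self [of "w $ x"] by (auto simp: add.commute)
    then have "0 \<le> (P t *v (?a - w)) $ x" "0 \<le> (P t *v (?a + w)) $ x"
      using P_nonneg [OF assms] by blast+
    then show ?thesis
      by (simp add: matrix_vector_mult_diff_distrib matrix_vector_right_distrib)
  qed
  then have "expect \<pi> (\<lambda>x. \<bar>(P t *v w) $ x\<bar>) \<le> expect \<pi> (\<lambda>x. (P t *v ?a) $ x)"
    by (intro expect_mono pi_nonneg)
  then show ?thesis by (simp add: expect_P)
qed

lemma P_minus_const: "P t *v w - (\<chi> x. c) = P t *v (w - (\<chi> x. c))"
  by (simp add: matrix_vector_mult_diff_distrib P_const)

lemma tv_P_le:
  assumes "0 \<le> t"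
  shows "tv \<pi> (P t *v w) \<le> tv \<pi> w"
  using expect_abs_P_le [OF assms, of "w - (\<chi> x. 1)"]
  by (simp add: tv_def flip: P_minus_const)

lemma tv_P_antimono:
  assumes "s \<le> t"
  shows "tv \<pi> (P t *v w) \<le> tv \<pi> (P s *v w)"
  using tv_P_le [of "t - s" "P s *v w"] assms by (simp flip: P_add)

lemma continuous_tv_P: "continuous_on UNIV (\<lambda>t. tv \<pi> (P t *v w))"
proof -
  have P: "continuous_on UNIV (\<lambda>t. (P t *v w) $ x)" for x
    using DERIV_isCont [OF P_DERIV] by (simp add: continuous_at_imp_continuous_on)
  show ?thesis
    unfolding tv_def expect_def
    by (intro P continuous_on_mult_left continuous_on_sum continuous_on_rabs continuous_on_diff
        continuous_on_const)
qed

text \<open>Gronwall's argument: the derivative of the second moment is minus twice the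
  Dirichlet form, hence at most \<open>- 2 \<gamma>\<close> times the second moment as long as the mean
  is zero, and the mean is preserved.\<close>

lemma variance_decay:
  assumes gamma: "\<And>w. \<gamma> * (expect \<pi> (\<lambda>x. (w $ x)\<^sup>2) - (expect \<pi> (\<lambda>x. w $ x))\<^sup>2)
                \<le> expect \<pi> (\<lambda>x. w $ x * (- (generator K *v w)) $ x)"
    and t: "0 \<le> t" and m: "expect \<pi> (\<lambda>x. w $ x) = 0"
  shows "expect \<pi> (\<lambda>x. ((P t *v w) $ x)\<^sup>2) \<le> exp (- 2 * \<gamma> * t) * expect \<pi> (\<lambda>x. (w $ x)\<^sup>2)"
proof -
  let ?u = "\<lambda>s x. (P s *v w) $ x"
  let ?\<phi> = "\<lambda>s. expect \<pi> (\<lambda>x. (?u s x)\<^sup>2)"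
  have D: "(?\<phi> has_field_derivative - (2 * expect \<pi> (\<lambda>x. ?u s x * (- (generator K *v (P s *v w))) $ x))) (at s)"
    (is "(_ has_field_derivative ?d s) _") for s
  proof -
    have "(?\<phi> has_field_derivative
       expect \<pi> (\<lambda>x. 2 * ?u s x ^ 1 * (generator K *v (P s *v w)) $ x)) (at s)"
      unfolding expect_def
      by (intro DERIV_sum DERIV_cmult) (rule derivative_eq_intros P_DERIV | simp)+
    then show ?thesis by (simp add: expect_def sum_distrib_left sum_negf mult_ac)
  qed
  have "exp (2 * \<gamma> * t) * ?\<phi> t \<le> exp (2 * \<gamma> * 0) * ?\<phi> 0"
  proof (rule DERIV_nonpos_imp_nonincreasing [OF t])
    fix s
    have "((\<lambda>s. exp (2 * \<gamma> * s) * ?\<phi> s) has_field_derivative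
        exp (2 * \<gamma> * s) * (2 * \<gamma> * ?\<phi> s + ?d s)) (at s)"
      by (rule derivative_eq_intros D refl)+ (simp add: algebra_simps)
    moreover have "2 * \<gamma> * ?\<phi> s + ?d s \<le> 0"
      using gamma [of "P s *v w"] by (simp add: expect_P m)
    ultimately show "\<exists>y. ((\<lambda>s. exp (2 * \<gamma> * s) * ?\<phi> s) has_field_derivative y) (at s) \<and> y \<le> 0"
      by (meson exp_ge_zero mult_nonneg_nonpos)
  qed
  then show ?thesis by (simp add: P_0 exp_minus field_simps)
qed

end

section \<open>Irreducibility and the Poincare constant\<close>

lemma stationary_law_matrix_pow:
  assumes "stationary_law T \<pi>"
  shows "\<pi> v* matrix_pow T k = \<pi>"
  using assms
  by (induction k) (simp_all add: stationary_law_def flip: vector_matrix_mul_assoc)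

lemma stationary_law_pos:
  fixes T :: "real ^ 'a ^ 'a"
  assumes T: "stochastic_matrix T" "irreducible_matrix T" and \<pi>: "stationary_law T \<pi>"
  shows "0 < \<pi> $ y"
proof -
  have nonneg: "0 \<le> \<pi> $ x" for x
    using \<pi> by (simp add: stationary_law_def)
  obtain x where x: "0 < \<pi> $ x"
  proof (rule ccontr)
    assume "\<not> thesis"
    then have "\<pi> $ x = 0" for x
      using that nonneg [of x] by (cases "\<pi> $ x = 0") (auto simp: less_le)
    then show False using \<pi> by (simp add: stationary_law_def)
  qed
  obtain k where k: "0 < matrix_pow T k $ x $ y"
    using T by (auto simp: irreducible_matrix_def)
  have "0 \<le> matrix_pow T k $ z $ y" for z
    using T(1) by (intro matrix_pow_nonneg) (auto simp: stochastic_matrix_def)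
  then have "0 < (\<Sum>z\<in>UNIV. matrix_pow T k $ z $ y * \<pi> $ z)"
    using nonneg x k by (intro sum_pos2 [of _ x]) auto
  also have "\<dots> = (\<pi> v* matrix_pow T k) $ y"
    by (simp add: vector_matrix_mult_def mult.commute)
  finally show ?thesis by (simp add: stationary_law_matrix_pow [OF \<pi>])
qed

definition dirichlet :: "real ^ 'a ^ 'a \<Rightarrow> real ^ 'a \<Rightarrow> real ^ 'a \<Rightarrow> real" where
  "dirichlet T \<pi> w = expect \<pi> (\<lambda>x. w $ x * (- (generator T *v w)) $ x)"

definition variance :: "real ^ 'a \<Rightarrow> real ^ 'a \<Rightarrow> real" where
  "variance \<pi> w = expect \<pi> (\<lambda>x. (w $ x)\<^sup>2) - (expect \<pi> (\<lambda>x. w $ x))\<^sup>2"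

context stationary_chain
begin

text \<open>Stationarity writes the Dirichlet form as a sum of
  squares. This shows at once that it is nonnegative, blind to constants, and equal for
  a chain and its time reversal.\<close>

lemma dirichlet_eq_squares:
  "dirichlet K \<pi> w = 1 / 2 * (\<Sum>x\<in>UNIV. \<Sum>y\<in>UNIV. \<pi> $ x * K $ x $ y * (w $ x - w $ y)\<^sup>2)"
proof -
  let ?sq = "\<chi> x. (w $ x)\<^sup>2"
  have 1: "(\<Sum>y\<in>UNIV. \<pi> $ x * K $ x $ y * (w $ x - w $ y)\<^sup>2)
      = \<pi> $ x * ((w $ x)\<^sup>2 - 2 * (w $ x * (K *v w) $ x) + (K *v ?sq) $ x)" (is "?l = _") for x
  proof -
    have "?l = (\<Sum>y\<in>UNIV. \<pi> $ x * ((w $ x)\<^sup>2 * K $ x $ y - 2 * (w $ x * (K $ x $ y * w $ y)) + K $ x $ y * (w $ y)\<^sup>2))"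
      by (intro sum.cong) (auto simp: power2_eq_square algebra_simps)
    also have "\<dots> = \<pi> $ x * ((w $ x)\<^sup>2 * (\<Sum>y\<in>UNIV. K $ x $ y) - 2 * (w $ x * (K *v w) $ x) + (K *v ?sq) $ x)"
      by (simp add: matrix_vector_mult_def sum_distrib_left sum.distrib sum_subtractf distrib_left right_diff_distrib)
    finally show ?thesis by (simp add: K_sum)
  qed
  have "1 / 2 * (\<Sum>x\<in>UNIV. \<Sum>y\<in>UNIV. \<pi> $ x * K $ x $ y * (w $ x - w $ y)\<^sup>2)
      = 1 / 2 * expect \<pi> (\<lambda>x. (w $ x)\<^sup>2 - 2 * (w $ x * (K *v w) $ x) + (K *v ?sq) $ x)"
    unfolding 1 expect_def ..
  also have "\<dots> = expect \<pi> (\<lambda>x. (w $ x)\<^sup>2) - expect \<pi> (\<lambda>x. w $ x * (K *v w) $ x)"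
    unfolding expect_add expect_diff expect_cmult expect_K by (simp add: vec_lambda_inverse)
  also have "\<dots> = dirichlet K \<pi> w"
    unfolding dirichlet_def by (simp add: generator_nth power2_eq_square right_diff_distrib expect_diff)
  finally show ?thesis ..
qed

lemma dirichlet_nonneg: "0 \<le> dirichlet K \<pi> w"
  unfolding dirichlet_eq_squares
  by (intro mult_nonneg_nonneg sum_nonneg) (auto simp: pi_nonneg K_nonneg)

lemma dirichlet_affine:
  "dirichlet K \<pi> (\<chi> x. a * (w $ x - c)) = a\<^sup>2 * dirichlet K \<pi> w"
proof -
  have "(a * (w $ x - c) - a * (w $ y - c))\<^sup>2 = a\<^sup>2 * (w $ x - w $ y)\<^sup>2" for x y
    by (simp add: power2_eq_square algebra_simps)
  then show ?thesis
    unfolding dirichlet_eq_squares by (simp add: sum_distrib_left mult_ac)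
qed

text \<open>Along each transition of positive probability the function cannot change, and
  irreducibility joins any two states by such transitions.\<close>

lemma dirichlet_eq_0_imp_const:
  assumes irr: "irreducible_matrix K" and pos: "\<And>x. 0 < \<pi> $ x" and 0: "dirichlet K \<pi> w = 0"
  shows "w $ x = w $ y"
proof -
  have "\<forall>x\<in>UNIV. (\<Sum>y\<in>UNIV. \<pi> $ x * K $ x $ y * (w $ x - w $ y)\<^sup>2) = 0"
    using 0 by (subst (asm) dirichlet_eq_squares, subst (asm) mult_eq_0_iff, subst (asm) sum_nonneg_eq_0_iff)
      (auto intro!: sum_nonneg simp: pi_nonneg K_nonneg)
  then have "\<pi> $ x * K $ x $ y * (w $ x - w $ y)\<^sup>2 = 0" for x y
    by (subst (asm) sum_nonneg_eq_0_iff) (auto simp: pi_nonneg K_nonneg)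
  then have step: "w $ x = w $ y" if "0 < K $ x $ y" for x y
    using pos [of x] that by (metis eq_iff_diff_eq_0 less_irrefl mult_eq_0_iff power_eq_0_iff)
  have "w $ x = w $ y" if "0 < matrix_pow K k $ x $ y" for k
    using that
  proof (induction k arbitrary: x)
    case 0
    then show ?case by (simp add: mat_def split: if_splits)
  next
    case (Suc k)
    then have "0 < (\<Sum>z\<in>UNIV. K $ x $ z * matrix_pow K k $ z $ y)"
      by (simp add: matrix_matrix_mult_def)
    then obtain z where "0 < K $ x $ z * matrix_pow K k $ z $ y"
      by (meson sum_nonpos not_le)
    then have "0 < K $ x $ z" "0 < matrix_pow K k $ z $ y"
      using K_nonneg [of x z] by (auto simp: zero_less_mult_iff)
    then show ?case using step Suc.IH by metis
  qed
  then show ?thesis using irr by (auto simp: irreducible_matrix_def)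
qed

lemma variance_eq: "variance \<pi> w = expect \<pi> (\<lambda>x. (w $ x - expect \<pi> (\<lambda>x. w $ x))\<^sup>2)"
  using expect_variance [OF pi_sum, of "\<lambda>x. w $ x"] by (simp add: variance_def)


text \<open>The functions of mean zero and second moment one form a compact set, because every
  state has positive mass; on it the Dirichlet form attains its minimum. Every other
  non-constant function is reduced to this set by an affine change, which does not
  affect the ratio of Dirichlet form to variance. With at least two states the set is not
  empty, as it contains the normalized indicator of a state.\<close>

lemma poincare_inequality_attained:
  assumes card: "2 \<le> CARD('a)" and pos: "\<And>x. 0 < \<pi> $ x"
  obtains w where "variance \<pi> w = 1" "\<And>v. dirichlet K \<pi> w * variance \<pi> v \<le> dirichlet K \<pi> v"
proof -
  let ?S = "{w. expect \<pi> (\<lambda>x. w $ x) = 0 \<and> expect \<pi> (\<lambda>x. (w $ x)\<^sup>2) = 1}"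
  have normalize: "(\<chi> x. (v $ x - expect \<pi> (\<lambda>x. v $ x)) / sqrt (variance \<pi> v)) \<in> ?S"
    if "0 < variance \<pi> v" for v
  proof -
    let ?m = "expect \<pi> (\<lambda>x. v $ x)" and ?a = "1 / sqrt (variance \<pi> v)"
    have "expect \<pi> (\<lambda>x. ?a * (v $ x - ?m)) = 0"
      unfolding expect_cmult expect_diff by (simp add: expect_const [OF pi_sum])
    moreover have "expect \<pi> (\<lambda>x. (?a * (v $ x - ?m))\<^sup>2) = 1"
      unfolding power_mult_distrib expect_cmult variance_eq [symmetric]
      using that by (simp add: power_divide)
    ultimately show ?thesis by (simp add: vec_lambda_inverse)
  qed
  have "compact ?S"
    unfolding compact_eq_bounded_closed
  proof
    have "continuous_on UNIV (\<lambda>w. expect \<pi> (\<lambda>x. w $ x))"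
      "continuous_on UNIV (\<lambda>w. expect \<pi> (\<lambda>x. (w $ x)\<^sup>2))"
      unfolding expect_def by (intro continuous_intros)+
    then show "closed ?S"
      by (intro closed_Collect_conj closed_Collect_eq) (auto intro: continuous_intros)
    have "norm w \<le> (\<Sum>x\<in>UNIV. 1 / sqrt (\<pi> $ x))" if "w \<in> ?S" for w
    proof -
      have "\<bar>w $ x\<bar> \<le> 1 / sqrt (\<pi> $ x)" for x
      proof -
        have "\<pi> $ x * (w $ x)\<^sup>2 \<le> expect \<pi> (\<lambda>x. (w $ x)\<^sup>2)"
          unfolding expect_def by (intro member_le_sum) (auto simp: pi_nonneg)
        then have "(w $ x)\<^sup>2 \<le> 1 / \<pi> $ x"
          using that pos [of x] by (simp add: field_simps)
        then have "sqrt ((w $ x)\<^sup>2) \<le> sqrt (1 / \<pi> $ x)"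
          by (rule real_sqrt_le_mono)
        then show ?thesis by (simp add: real_sqrt_divide)
      qed
      then show ?thesis
        using norm_le_l1_cart [of w] by (meson order_trans sum_mono)
    qed
    then show "bounded ?S" by (auto simp: bounded_iff)
  qed
  moreover have "?S \<noteq> {}"
  proof -
    obtain x y :: 'a where xy: "x \<noteq> y"
      using card by (metis card_2_iff' card_le_Suc0_iff_eq finite not_less_eq_eq numeral_2_eq_2 UNIV_I)
    let ?v = "axis x 1 :: real ^ 'a"
    have "0 < variance \<pi> ?v"
    proof (rule ccontr)
      assume "\<not> 0 < variance \<pi> ?v"
      then have "expect \<pi> (\<lambda>z. (?v $ z - expect \<pi> (\<lambda>z. ?v $ z))\<^sup>2) = 0"
        unfolding variance_eq using expect_nonneg [OF pi_nonneg, of "\<lambda>z. (?v $ z - expect \<pi> (\<lambda>z. ?v $ z))\<^sup>2"]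
        by simp
      then have "\<pi> $ z * (?v $ z - expect \<pi> (\<lambda>z. ?v $ z))\<^sup>2 = 0" for z
        unfolding expect_def by (subst (asm) sum_nonneg_eq_0_iff) (auto simp: pi_nonneg)
      then have "?v $ z = expect \<pi> (\<lambda>z. ?v $ z)" for z
        using pos [of z] by (metis less_irrefl mult_eq_0_iff power_eq_0_iff eq_iff_diff_eq_0)
      then have "?v $ x = ?v $ y" by metis
      then show False using xy by (simp add: axis_def)
    qed
    then show ?thesis using normalize by blast
  qed
  moreover have "continuous_on ?S (dirichlet K \<pi>)"
    unfolding dirichlet_eq_squares [abs_def] by (intro continuous_intros)
  ultimately have "\<exists>w\<in>?S. \<forall>v\<in>?S. dirichlet K \<pi> w \<le> dirichlet K \<pi> v"
    by (rule continuous_attains_inf)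
  then obtain w where w: "w \<in> ?S" "\<And>v. v \<in> ?S \<Longrightarrow> dirichlet K \<pi> w \<le> dirichlet K \<pi> v"
    by blast
  have "dirichlet K \<pi> w * variance \<pi> v \<le> dirichlet K \<pi> v" for v
  proof (cases "0 < variance \<pi> v")
    case True
    let ?a = "1 / sqrt (variance \<pi> v)"
    have "dirichlet K \<pi> w \<le> dirichlet K \<pi> (\<chi> x. ?a * (v $ x - expect \<pi> (\<lambda>x. v $ x)))"
      using w(2) [OF normalize [OF True]] by simp
    also have "\<dots> = dirichlet K \<pi> v / variance \<pi> v"
      unfolding dirichlet_affine using True by (simp add: power_divide)
    finally show ?thesis using True by (simp add: field_simps)
  next
    case False
    then show ?thesis
      using dirichlet_nonneg [of v] dirichlet_nonneg [of w]
      by (meson linorder_not_less mult_nonneg_nonpos order_trans)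
  qed
  moreover have "variance \<pi> w = 1" using w(1) by (simp add: variance_def)
  ultimately show thesis using that by blast
qed

text \<open>The greatest constant exists because the minimizer of the previous lemma attains it,
  and it is positive because a minimizer of zero energy would be constant.\<close>

lemma
  assumes card: "2 \<le> CARD('a)" and pos: "\<And>x. 0 < \<pi> $ x" and irr: "irreducible_matrix K"
  shows poincare_constant_pos: "0 < poincare_constant K \<pi>"
    and poincare_inequality: "poincare_constant K \<pi> * variance \<pi> v \<le> dirichlet K \<pi> v"
proof -
  obtain w where w: "variance \<pi> w = 1" "\<And>v. dirichlet K \<pi> w * variance \<pi> v \<le> dirichlet K \<pi> v"
    using poincare_inequality_attained [OF card pos] by blast
  have eq: "poincare_constant K \<pi> = dirichlet K \<pi> w"
    unfolding poincare_constant_def dirichlet_def [symmetric] variance_def [symmetric]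
  proof (rule Greatest_equality)
    show "\<forall>v. dirichlet K \<pi> w * variance \<pi> v \<le> dirichlet K \<pi> v" using w(2) by blast
    show "\<gamma> \<le> dirichlet K \<pi> w" if "\<forall>v. \<gamma> * variance \<pi> v \<le> dirichlet K \<pi> v" for \<gamma>
      using that w(1) by (metis mult.right_neutral)
  qed
  have "dirichlet K \<pi> w \<noteq> 0"
  proof
    assume "dirichlet K \<pi> w = 0"
    then have "w = (\<chi> x. w $ undefined)"
      using dirichlet_eq_0_imp_const [OF irr pos] by (simp add: vec_eq_iff)
    moreover have "variance \<pi> (\<chi> x. c) = 0" for c
      by (simp add: variance_def vec_lambda_inverse expect_const [OF pi_sum])
    ultimately have "variance \<pi> w = 0" by metis
    then show False using w(1) by simp
  qed
  then show "0 < poincare_constant K \<pi>"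
    using dirichlet_nonneg [of w] by (simp add: eq less_le)
  show "poincare_constant K \<pi> * variance \<pi> v \<le> dirichlet K \<pi> v"
    using w(2) by (simp add: eq)
qed

lemma time_reversal_stationary_chain:
  assumes pos: "\<And>x. 0 < \<pi> $ x"
  shows "stationary_chain (time_reversal \<pi> K) \<pi>"
proof
  have "(\<Sum>y\<in>UNIV. time_reversal \<pi> K $ x $ y) = 1" for x
    using pos [of x] by (simp add: time_reversal_def pi_stat flip: sum_divide_distrib)
  then show "stochastic_matrix (time_reversal \<pi> K)"
    by (simp add: stochastic_matrix_def time_reversal_def pi_nonneg K_nonneg)
  have "(\<pi> v* time_reversal \<pi> K) $ y = \<pi> $ y" for y
  proof -
    have "(\<pi> v* time_reversal \<pi> K) $ y = (\<Sum>x\<in>UNIV. \<pi> $ y * K $ y $ x)"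
      unfolding vector_matrix_mult_def using pos by (simp add: time_reversal_def less_imp_neq [symmetric])
    also have "\<dots> = \<pi> $ y" by (simp add: K_sum flip: sum_distrib_left)
    finally show ?thesis .
  qed
  then show "stationary_law (time_reversal \<pi> K) \<pi>"
    by (simp add: stationary_law_def pi_nonneg pi_sum vec_eq_iff)
qed

text \<open>The Poincare constant belongs to \<open>T\<close> while densities evolve under the time reversal;
  this lemma transfers the Poincare inequality from one to the other.\<close>

lemma dirichlet_time_reversal:
  assumes pos: "\<And>x. 0 < \<pi> $ x"
  shows "dirichlet (time_reversal \<pi> K) \<pi> w = dirichlet K \<pi> w"
proof -
  interpret R: stationary_chain "time_reversal \<pi> K" \<pi>
    using pos by (rule time_reversal_stationary_chain)
  have "(\<Sum>x\<in>UNIV. \<Sum>y\<in>UNIV. \<pi> $ x * time_reversal \<pi> K $ x $ y * (w $ x - w $ y)\<^sup>2)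
      = (\<Sum>x\<in>UNIV. \<Sum>y\<in>UNIV. \<pi> $ y * K $ y $ x * (w $ y - w $ x)\<^sup>2)"
    using pos by (simp add: time_reversal_def less_imp_neq [symmetric] power2_commute)
  then show ?thesis
    unfolding dirichlet_eq_squares R.dirichlet_eq_squares by (subst (2) sum.swap) simp
qed

end

section \<open>From varentropy to mixing\<close>

lemma varent_nonneg:
  assumes "\<And>x. 0 \<le> \<pi> $ x" "\<And>x. 0 \<le> g $ x"
  shows "0 \<le> varent \<pi> g"
  unfolding varent_def using assms by (intro expect_nonneg) auto

text \<open>Chebyshev's inequality for \<open>ln g\<close> under the law with density \<open>g\<close>. States with
  \<open>g = 0\<close> carry no mass, so the distance hypothesis is restricted to states with
  \<open>g > 0\<close>, where \<open>ln g\<close> is meaningful.\<close>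

lemma varent_chebyshev:
  assumes "\<And>x. 0 \<le> \<pi> $ x" "\<And>x. 0 \<le> g $ x"
    and "\<And>x. B x \<Longrightarrow> 0 < g $ x \<Longrightarrow>
          s\<^sup>2 \<le> (ln (g $ x) - expect \<pi> (\<lambda>y. g $ y * ln (g $ y)))\<^sup>2"
  shows "s\<^sup>2 * expect \<pi> (\<lambda>x. if B x then g $ x else 0) \<le> varent \<pi> g"
  unfolding varent_def expect_cmult [symmetric]
proof (intro expect_mono assms(1))
  fix x
  show "s\<^sup>2 * (if B x then g $ x else 0)
      \<le> g $ x * (ln (g $ x) - expect \<pi> (\<lambda>y. g $ y * ln (g $ y)))\<^sup>2"
    using assms(2) [of x] assms(3) [of x]
    by (cases "g $ x = 0") (auto simp: mult.commute [of "s\<^sup>2"] intro!: mult_left_mono)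
qed

context stationary_chain
begin

text \<open>The event \<open>g \<ge> 2 / \<epsilon>\<close> has stationary probability at most \<open>\<epsilon> / 2\<close> by Markov's
  inequality, so by definition of the total variation distance its mass under \<open>g\<close> is at
  most \<open>1 - \<epsilon> + \<epsilon> / 2\<close>. The proof integrates a pointwise form of this, in which
  \<open>(\<bar>g - 1\<bar> + (g - 1)) / 2\<close> is the positive part of \<open>g - 1\<close>.\<close>

lemma mass_below_ge:
  assumes g: "g \<in> densities \<pi>" and tv: "tv \<pi> g \<le> 1 - \<epsilon>" and \<epsilon>: "0 < \<epsilon>"
  shows "\<epsilon> / 2 \<le> expect \<pi> (\<lambda>x. if g $ x < 2 / \<epsilon> then g $ x else 0)"
proof -
  have g0: "0 \<le> g $ x" and g1: "expect \<pi> (\<lambda>x. g $ x) = 1" for x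
    using g by (auto simp: densities_def)
  let ?b = "\<lambda>x. if g $ x < 2 / \<epsilon> then g $ x else 0"
  have "g $ x - ?b x \<le> (1 / 2 * \<bar>g $ x - 1\<bar> + 1 / 2 * (g $ x - 1)) + \<epsilon> / 2 * g $ x" for x
  proof (cases "g $ x < 2 / \<epsilon>")
    case True
    have "0 \<le> \<epsilon> / 2 * g $ x" using g0 \<epsilon> by simp
    moreover have "0 \<le> 1 / 2 * \<bar>g $ x - 1\<bar> + 1 / 2 * (g $ x - 1)" by (simp add: abs_if field_simps)
    ultimately show ?thesis using True by simp
  next
    case False
    then have "1 \<le> \<epsilon> / 2 * g $ x" using \<epsilon> by (simp add: field_simps)
    moreover have "g $ x - 1 \<le> 1 / 2 * \<bar>g $ x - 1\<bar> + 1 / 2 * (g $ x - 1)" by (simp add: abs_if field_simps)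
    ultimately show ?thesis using False by simp
  qed
  then have "expect \<pi> (\<lambda>x. g $ x - ?b x)
      \<le> expect \<pi> (\<lambda>x. (1 / 2 * \<bar>g $ x - 1\<bar> + 1 / 2 * (g $ x - 1)) + \<epsilon> / 2 * g $ x)"
    by (intro expect_mono pi_nonneg)
  also have "\<dots> = tv \<pi> g + \<epsilon> / 2"
    unfolding expect_add expect_cmult expect_diff g1 by (simp add: tv_def expect_const [OF pi_sum])
  finally show ?thesis
    using tv unfolding expect_diff g1 by linarith
qed

text \<open>A reverse Pinsker inequality. At distance at least \<open>H - ln (2 / \<epsilon>)\<close> below its mean
  \<open>H\<close>, the variable \<open>ln g\<close> still has mass \<open>\<epsilon> / 2\<close> by the previous lemma, so
  Chebyshev's inequality bounds that distance by \<open>sqrt (2 V / \<epsilon>)\<close>.\<close>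

lemma relative_entropy_le:
  assumes g: "g \<in> densities \<pi>" and tv: "tv \<pi> g \<le> 1 - \<epsilon>" and \<epsilon>: "0 < \<epsilon>"
    and V: "varent \<pi> g \<le> V"
  shows "expect \<pi> (\<lambda>x. g $ x * ln (g $ x)) \<le> ln (2 / \<epsilon>) + sqrt (2 * V / \<epsilon>)"
proof (rule ccontr)
  let ?H = "expect \<pi> (\<lambda>x. g $ x * ln (g $ x))"
  define s where "s = ?H - ln (2 / \<epsilon>)"
  assume "\<not> ?thesis"
  then have s: "sqrt (2 * V / \<epsilon>) < s" by (simp add: s_def)
  have g0: "0 \<le> g $ x" for x using g by (simp add: densities_def)
  have V0: "0 \<le> V" using varent_nonneg [of \<pi> g, OF pi_nonneg g0] V by linarith
  have s0: "0 < s" using s V0 \<epsilon> by (smt (verit) real_sqrt_ge_zero divide_nonneg_pos)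
  have "s\<^sup>2 * expect \<pi> (\<lambda>x. if g $ x < 2 / \<epsilon> then g $ x else 0) \<le> varent \<pi> g"
  proof (rule varent_chebyshev [OF pi_nonneg g0])
    fix x assume "g $ x < 2 / \<epsilon>" "0 < g $ x"
    then have "ln (g $ x) < ln (2 / \<epsilon>)" using \<epsilon> by (intro ln_less_cancel_iff [THEN iffD2]) auto
    then have "s \<le> ?H - ln (g $ x)" by (simp add: s_def)
    then show "s\<^sup>2 \<le> (ln (g $ x) - ?H)\<^sup>2"
      using s0 by (subst power2_commute) (simp add: power_mono)
  qed
  moreover have "s\<^sup>2 * (\<epsilon> / 2) \<le> s\<^sup>2 * expect \<pi> (\<lambda>x. if g $ x < 2 / \<epsilon> then g $ x else 0)"
    by (intro mult_left_mono mass_below_ge g tv \<epsilon>) simp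
  ultimately have "s\<^sup>2 * (\<epsilon> / 2) \<le> V" using V by linarith
  then have "s\<^sup>2 \<le> 2 * V / \<epsilon>" using \<epsilon> by (simp add: field_simps)
  then have "s \<le> sqrt (2 * V / \<epsilon>)" by (rule real_le_rsqrt)
  then show False using s by simp
qed

text \<open>The two parts of the density are controlled in different norms: the possibly unbounded
  part \<open>r\<close> only in \<open>L\<^sup>1\<close>, where \<open>P\<^sub>t r\<close> and its mean contribute at most twice the mass
  of \<open>r\<close>; the part \<open>h\<close> in \<open>L\<^sup>2\<close>, where the distance to its mean decays exponentially.\<close>

lemma tv_P_truncation:
  assumes gamma: "\<And>w. \<gamma> * variance \<pi> w \<le> dirichlet K \<pi> w"
    and t: "0 \<le> t" and r: "\<And>x. 0 \<le> r $ x" and g: "expect \<pi> (\<lambda>x. (h + r) $ x) = 1"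
  shows "tv \<pi> (P t *v (h + r))
           \<le> 1 / 2 * (exp (- \<gamma> * t) * sqrt (expect \<pi> (\<lambda>x. (h $ x)\<^sup>2))) + expect \<pi> (\<lambda>x. r $ x)"
proof -
  define a b where "a = expect \<pi> (\<lambda>x. h $ x)" and "b = expect \<pi> (\<lambda>x. r $ x)"
  have ab: "a + b = 1" using g by (simp add: a_def b_def expect_add)
  have b0: "0 \<le> b" unfolding b_def using r by (intro expect_nonneg pi_nonneg)
  let ?h = "h - (\<chi> x. a)"
  have split: "\<bar>(P t *v (h + r)) $ x - 1\<bar> \<le> \<bar>(P t *v ?h) $ x\<bar> + \<bar>(P t *v r) $ x\<bar> + b" for x
  proof -
    have "(P t *v (h + r)) $ x - 1 = (P t *v ?h) $ x + (P t *v r) $ x - b"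
      using ab by (simp add: matrix_vector_right_distrib matrix_vector_mult_diff_distrib P_const)
    then show ?thesis using b0 by linarith
  qed
  have "expect \<pi> (\<lambda>x. \<bar>(P t *v (h + r)) $ x - 1\<bar>)
      \<le> expect \<pi> (\<lambda>x. \<bar>(P t *v ?h) $ x\<bar> + \<bar>(P t *v r) $ x\<bar> + b)"
    by (intro expect_mono pi_nonneg split)
  also have "\<dots> = expect \<pi> (\<lambda>x. \<bar>(P t *v ?h) $ x\<bar>) + expect \<pi> (\<lambda>x. \<bar>(P t *v r) $ x\<bar>) + b"
    by (simp add: expect_add expect_const [OF pi_sum])
  also have "expect \<pi> (\<lambda>x. \<bar>(P t *v r) $ x\<bar>) \<le> b"
    using expect_abs_P_le [OF t, of r] r by (simp add: b_def)
  also have "expect \<pi> (\<lambda>x. \<bar>(P t *v ?h) $ x\<bar>) \<le> sqrt (expect \<pi> (\<lambda>x. ((P t *v ?h) $ x)\<^sup>2))"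
    by (intro expect_abs_le_sqrt pi_nonneg pi_sum)
  also have "expect \<pi> (\<lambda>x. ((P t *v ?h) $ x)\<^sup>2) \<le> exp (- 2 * \<gamma> * t) * expect \<pi> (\<lambda>x. (?h $ x)\<^sup>2)"
    by (rule variance_decay [OF gamma [unfolded variance_def dirichlet_def] t])
      (simp add: expect_diff expect_const [OF pi_sum] a_def)
  also have "expect \<pi> (\<lambda>x. (?h $ x)\<^sup>2) \<le> expect \<pi> (\<lambda>x. (h $ x)\<^sup>2)"
    using expect_variance [OF pi_sum, of "\<lambda>x. h $ x"] by (simp add: a_def)
  also have "sqrt (exp (- 2 * \<gamma> * t) * expect \<pi> (\<lambda>x. (h $ x)\<^sup>2))
      = exp (- \<gamma> * t) * sqrt (expect \<pi> (\<lambda>x. (h $ x)\<^sup>2))"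
  proof -
    have "exp (- 2 * \<gamma> * t) = (exp (- \<gamma> * t))\<^sup>2"
      by (simp flip: exp_double)
    then show ?thesis by (simp add: real_sqrt_mult)
  qed
  finally show ?thesis by (simp add: tv_def b_def)
qed

text \<open>The heart of the matter: the window length after a time with distance at most
  \<open>1 - \<epsilon>\<close>. The bound \<open>V\<close> may exceed the varentropy, so that the worst-case statement
  can use the maximum over all starting points.\<close>

lemma tv_P_le_of_varent:
  assumes gamma: "\<And>w. \<gamma> * variance \<pi> w \<le> dirichlet K \<pi> w" and \<gamma>: "0 < \<gamma>"
    and g: "g \<in> densities \<pi>" and tv: "tv \<pi> g \<le> 1 - \<epsilon>" and \<epsilon>: "0 < \<epsilon>" "\<epsilon> < 1 / 2"
    and V: "varent \<pi> g \<le> V"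
  shows "tv \<pi> (P (2 / (\<gamma> * \<epsilon>\<^sup>2) * (1 + sqrt V)) *v g) \<le> \<epsilon>"
proof -
  define t where "t = 2 / (\<gamma> * \<epsilon>\<^sup>2) * (1 + sqrt V)"
  define H where "H = expect \<pi> (\<lambda>x. g $ x * ln (g $ x))"
  \<comment> \<open>The summand 1 keeps \<open>s\<close> positive when \<open>V = 0\<close>.\<close>
  define s where "s = sqrt (2 * V / \<epsilon>) + 1"
  define \<theta> where "\<theta> = H + s"
  define h r :: "real ^ 'a" where "h = (\<chi> x. if ln (g $ x) \<le> \<theta> then g $ x else 0)"
    and "r = (\<chi> x. if \<theta> < ln (g $ x) then g $ x else 0)"
  have g0: "0 \<le> g $ x" and g1: "expect \<pi> (\<lambda>x. g $ x) = 1" for x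
    using g by (auto simp: densities_def)
  have V0: "0 \<le> V" using varent_nonneg [of \<pi> g, OF pi_nonneg g0] V by linarith
  have q0: "0 \<le> sqrt (2 * V / \<epsilon>)" using V0 \<epsilon> by simp
  have s0: "0 < s" using q0 unfolding s_def by linarith
  have t0: "0 \<le> t" using \<gamma> V0 by (simp add: t_def)
  have hr: "h + r = g" by (simp add: h_def r_def vec_eq_iff)
  have r: "0 \<le> r $ x" for x using g0 by (simp add: r_def)
  have mass: "expect \<pi> (\<lambda>x. r $ x) \<le> \<epsilon> / 2"
  proof -
    have "s\<^sup>2 * expect \<pi> (\<lambda>x. if \<theta> < ln (g $ x) then g $ x else 0) \<le> varent \<pi> g"
    proof (rule varent_chebyshev [OF pi_nonneg g0])
      fix x assume "\<theta> < ln (g $ x)"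
      then show "s\<^sup>2 \<le> (ln (g $ x) - expect \<pi> (\<lambda>x. g $ x * ln (g $ x)))\<^sup>2"
        unfolding H_def [symmetric] using s0 by (intro power_mono) (auto simp: \<theta>_def)
    qed
    then have "s\<^sup>2 * expect \<pi> (\<lambda>x. r $ x) \<le> V" using V by (simp add: r_def)
    also have "V \<le> s\<^sup>2 * (\<epsilon> / 2)"
    proof -
      have "(sqrt (2 * V / \<epsilon>))\<^sup>2 \<le> s\<^sup>2"
        using q0 by (intro power_mono) (simp_all add: s_def)
      then have "2 * V / \<epsilon> \<le> s\<^sup>2" using V0 \<epsilon> by simp
      then show ?thesis using \<epsilon> by (simp add: field_simps)
    qed
    finally show ?thesis using s0 by simp
  qed
  have "expect \<pi> (\<lambda>x. (h $ x)\<^sup>2) \<le> expect \<pi> (\<lambda>x. exp \<theta> * g $ x)"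
  proof (intro expect_mono pi_nonneg)
    fix x
    show "(h $ x)\<^sup>2 \<le> exp \<theta> * g $ x"
    proof (cases "0 < g $ x \<and> ln (g $ x) \<le> \<theta>")
      case True
      then have "g $ x \<le> exp \<theta>" by (metis exp_le_cancel_iff exp_ln)
      then have "g $ x * g $ x \<le> exp \<theta> * g $ x" using g0 by (intro mult_right_mono)
      then show ?thesis using True by (simp add: h_def power2_eq_square)
    next
      case False
      then have "h $ x = 0" using g0 [of x] by (auto simp: h_def)
      then show ?thesis using g0 [of x] by simp
    qed
  qed
  then have "sqrt (expect \<pi> (\<lambda>x. (h $ x)\<^sup>2)) \<le> sqrt (exp \<theta>)"
    by (simp add: expect_cmult g1)
  also have "sqrt (exp \<theta>) = exp (\<theta> / 2)"
    by (rule real_sqrt_unique) (simp_all flip: exp_double)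
  finally have L2: "sqrt (expect \<pi> (\<lambda>x. (h $ x)\<^sup>2)) \<le> exp (\<theta> / 2)" .
  \<comment> \<open>After time \<open>t\<close> the factor \<open>exp (- \<gamma> t)\<close> brings the \<open>L\<^sup>2\<close> bound \<open>exp (\<theta> / 2)\<close> below \<open>\<epsilon>\<close>.\<close>
  have time: "\<theta> / 2 - ln \<epsilon> \<le> \<gamma> * t"
  proof -
    \<comment> \<open>With \<open>u = 1 / \<epsilon> > 2\<close>, logarithms are below \<open>u - 1\<close> and \<open>2 u - 1\<close>, and \<open>2 u \<le> u\<^sup>2\<close>.\<close>
    define u where "u = 1 / \<epsilon>"
    have u: "2 < u" using \<epsilon> by (simp add: u_def field_simps)
    have lnu: "ln u \<le> u - 1" using u by (intro ln_le_minus_one) simp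
    have ln2u: "ln (2 * u) \<le> 2 * u - 1" using u by (intro ln_le_minus_one) simp
    have "sqrt (2 * u) \<le> u"
      using u by (intro real_le_lsqrt) (auto simp: power2_eq_square)
    then have q: "sqrt (2 * V / \<epsilon>) \<le> u * sqrt V"
      using V0 mult_right_mono [of "sqrt (2 * u)" u "sqrt V"]
      by (simp add: u_def mult_ac flip: real_sqrt_mult)
    have "H \<le> ln (2 * u) + sqrt (2 * V / \<epsilon>)"
      using relative_entropy_le [OF g tv \<epsilon>(1) V] by (simp add: H_def u_def)
    then have "\<theta> \<le> 2 * u + 2 * (u * sqrt V)"
      using q ln2u by (simp add: \<theta>_def s_def)
    have "- ln \<epsilon> = ln u" using \<epsilon> by (simp add: u_def ln_div)
    have "\<theta> / 2 - ln \<epsilon> \<le> 2 * u * (1 + sqrt V)"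
    proof -
      have "0 \<le> u * sqrt V" using u V0 by simp
      moreover have "2 * u * (1 + sqrt V) = 2 * u + 2 * (u * sqrt V)" by (simp add: algebra_simps)
      ultimately show ?thesis
        using lnu \<open>\<theta> \<le> 2 * u + 2 * (u * sqrt V)\<close> \<open>- ln \<epsilon> = ln u\<close> by linarith
    qed
    also have "\<dots> \<le> 2 * u * u * (1 + sqrt V)"
      using u V0 by (intro mult_right_mono) auto
    also have "\<dots> = \<gamma> * t" using \<gamma> by (simp add: t_def u_def power2_eq_square)
    finally show ?thesis .
  qed
  have "exp (- \<gamma> * t) * exp (\<theta> / 2) = exp (\<theta> / 2 - \<gamma> * t)"
    by (simp flip: exp_add)
  also have "\<dots> \<le> exp (ln \<epsilon>)" using time by simp
  finally have "exp (- \<gamma> * t) * exp (\<theta> / 2) \<le> \<epsilon>" using \<epsilon> by simp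
  then have "exp (- \<gamma> * t) * sqrt (expect \<pi> (\<lambda>x. (h $ x)\<^sup>2)) \<le> \<epsilon>"
    using L2 by (meson exp_ge_zero mult_left_mono order_trans)
  then show ?thesis
    using tv_P_truncation [OF gamma t0 r, of h] mass by (simp add: hr g1 t_def)
qed

text \<open>Ensures that the minimum defining the mixing time is over a nonempty set. The explicit
  time comes from \<open>\<gamma> t \<le> exp (\<gamma> t)\<close>.\<close>

lemma ex_tv_P_le:
  assumes gamma: "\<And>w. \<gamma> * variance \<pi> w \<le> dirichlet K \<pi> w" and \<gamma>: "0 < \<gamma>"
    and f: "f \<in> densities \<pi>" and \<epsilon>: "0 < \<epsilon>"
  shows "\<exists>t\<ge>0. tv \<pi> (P t *v f) \<le> \<epsilon>"
proof -
  let ?c = "sqrt (expect \<pi> (\<lambda>x. (f $ x)\<^sup>2))"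
  define t where "t = ?c / (\<gamma> * \<epsilon>)"
  have c0: "0 \<le> ?c" by (intro real_sqrt_ge_zero expect_nonneg pi_nonneg) simp
  then have t0: "0 \<le> t" using \<gamma> \<epsilon> by (simp add: t_def)
  have "?c = \<epsilon> * (\<gamma> * t)" using \<gamma> \<epsilon> by (simp add: t_def)
  also have "\<dots> \<le> \<epsilon> * exp (\<gamma> * t)"
    using \<epsilon> exp_ge_add_one_self [of "\<gamma> * t"] by (intro mult_left_mono) linarith+
  finally have "exp (- \<gamma> * t) * ?c \<le> \<epsilon>" by (simp add: exp_minus field_simps)
  moreover have "tv \<pi> (P t *v f) \<le> 1 / 2 * (exp (- \<gamma> * t) * ?c)"
    using tv_P_truncation [OF gamma t0, of 0 f] f by (simp add: densities_def expect_def)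
  ultimately show ?thesis using t0 \<epsilon> by (intro exI [of _ t]) auto
qed

text \<open>The distance is continuous in time, so the set of admissible times is closed and
  contains its infimum.\<close>

lemma Least_tv_P:
  fixes f :: "real ^ 'a"
  assumes "\<exists>t\<ge>0. tv \<pi> (P t *v f) \<le> \<epsilon>"
  defines "\<tau> \<equiv> LEAST t. 0 \<le> t \<and> tv \<pi> (P t *v f) \<le> \<epsilon>"
  shows Least_tv_P_nonneg: "0 \<le> \<tau>"
    and tv_P_Least: "tv \<pi> (P \<tau> *v f) \<le> \<epsilon>"
    and Least_tv_P_le: "0 \<le> t \<Longrightarrow> tv \<pi> (P t *v f) \<le> \<epsilon> \<Longrightarrow> \<tau> \<le> t"
proof -
  let ?S = "{t. 0 \<le> t \<and> tv \<pi> (P t *v f) \<le> \<epsilon>}"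
  have bdd: "bdd_below ?S" by (intro bdd_belowI [of _ 0]) simp
  have "closed ?S"
    by (intro closed_Collect_conj closed_Collect_le continuous_tv_P) (auto intro: continuous_intros)
  then have Inf: "Inf ?S \<in> ?S"
    using assms(1) bdd by (intro closed_contains_Inf) auto
  have "\<tau> = Inf ?S"
    unfolding \<tau>_def using Inf bdd by (intro Least_equality) (auto intro: cInf_lower)
  then show "0 \<le> \<tau>" "tv \<pi> (P \<tau> *v f) \<le> \<epsilon>" "0 \<le> t \<Longrightarrow> tv \<pi> (P t *v f) \<le> \<epsilon> \<Longrightarrow> \<tau> \<le> t"
    using Inf bdd by (auto intro: cInf_lower)
qed

end

lemma dirac_density_in_densities:
  assumes "\<And>x. 0 < \<pi> $ x"
  shows "dirac_density \<pi> x \<in> densities \<pi>"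
proof -
  have "(\<Sum>y\<in>UNIV. \<pi> $ y * dirac_density \<pi> x $ y) = (\<Sum>y\<in>UNIV. if y = x then 1 else 0)"
    using assms by (intro sum.cong) (auto simp: dirac_density_def less_imp_neq [symmetric])
  then show ?thesis
    using assms [of x] by (simp add: densities_def expect_def) (simp add: dirac_density_def)
qed

theorem theorem5p1:
  fixes T :: "real ^ 'a ^ 'a" and \<pi> :: "real ^ 'a"
  assumes "2 \<le> CARD('a)"
    and "stochastic_matrix T"
    and "irreducible_matrix T"
    and "stationary_law T \<pi>"
  shows "(\<forall>f \<epsilon>. f \<in> densities \<pi> \<and> 0 < \<epsilon> \<and> \<epsilon> < 1 / 2 \<longrightarrow>
            wmix_from T \<pi> f \<epsilon>
              \<le> 2 / (poincare_constant T \<pi> * \<epsilon>\<^sup>2) *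
                 (1 + sqrt (varent \<pi> (semigroup_star T \<pi> (tmix_from T \<pi> f (1 - \<epsilon>)) *v f))))
       \<and> (\<forall>\<epsilon>. 0 < \<epsilon> \<and> \<epsilon> < 1 / 2 \<longrightarrow>
            wmix T \<pi> \<epsilon>
              \<le> 2 / (poincare_constant T \<pi> * \<epsilon>\<^sup>2) *
                 (1 + sqrt (MAX x. varent \<pi>
                        (semigroup_star T \<pi> (tmix T \<pi> (1 - \<epsilon>)) *v dirac_density \<pi> x))))"
proof -
  interpret C: stationary_chain T \<pi>
    using assms by unfold_locales
  have pos: "0 < \<pi> $ x" for x
    using assms by (intro stationary_law_pos)
  interpret R: stationary_chain "time_reversal \<pi> T" \<pi>
    using pos by (rule C.time_reversal_stationary_chain)
  have P: "semigroup_star T \<pi> = R.P"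
    by (simp add: fun_eq_iff semigroup_star_def R.P_def)
  define \<gamma> where "\<gamma> = poincare_constant T \<pi>"
  have \<gamma>: "0 < \<gamma>"
    unfolding \<gamma>_def using assms(1) pos assms(3) by (rule C.poincare_constant_pos)
  have gamma: "\<gamma> * variance \<pi> w \<le> dirichlet (time_reversal \<pi> T) \<pi> w" for w
    unfolding \<gamma>_def C.dirichlet_time_reversal [OF pos]
    using assms(1) pos assms(3) by (rule C.poincare_inequality)
  note ex = R.ex_tv_P_le [OF gamma \<gamma>]
  have tmix_nonneg: "0 \<le> tmix_from T \<pi> f \<delta>"
    and tv_tmix: "tv \<pi> (R.P (tmix_from T \<pi> f \<delta>) *v f) \<le> \<delta>"
    and tmix_le: "0 \<le> t \<Longrightarrow> tv \<pi> (R.P t *v f) \<le> \<delta> \<Longrightarrow> tmix_from T \<pi> f \<delta> \<le> t"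
    if "f \<in> densities \<pi>" "0 < \<delta>" for f \<delta> t
    using R.Least_tv_P [OF ex [OF that]] unfolding tmix_from_def P by auto
  \<comment> \<open>The time \<open>t\<close> may be later than the mixing time of \<open>f\<close> at level \<open>1 - \<epsilon>\<close>, since the distance
      decreases; the worst-case bound needs this freedom.\<close>
  have key: "tmix_from T \<pi> f \<epsilon> \<le> 2 / (\<gamma> * \<epsilon>\<^sup>2) * (1 + sqrt V) + t"
    if f: "f \<in> densities \<pi>" and \<epsilon>: "0 < \<epsilon>" "\<epsilon> < 1 / 2" and t: "tmix_from T \<pi> f (1 - \<epsilon>) \<le> t"
      and V: "varent \<pi> (R.P t *v f) \<le> V"
    for f \<epsilon> t V
  proof -
    have t0: "0 \<le> t" using tmix_nonneg [OF f, of "1 - \<epsilon>"] t \<epsilon> by simp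
    have g: "R.P t *v f \<in> densities \<pi>"
      using f by (auto simp: densities_def R.expect_P R.P_nonneg t0)
    have tv: "tv \<pi> (R.P t *v f) \<le> 1 - \<epsilon>"
      using R.tv_P_antimono [OF t, of f] tv_tmix [OF f, of "1 - \<epsilon>"] \<epsilon> by simp
    have "0 \<le> V"
      using varent_nonneg [of \<pi> "R.P t *v f"] g V by (force simp: densities_def R.pi_nonneg)
    then have "0 \<le> 2 / (\<gamma> * \<epsilon>\<^sup>2) * (1 + sqrt V) + t" using t0 \<gamma> by simp
    then show ?thesis
      using R.tv_P_le_of_varent [OF gamma \<gamma> g tv \<epsilon> V]
      by (intro tmix_le f \<epsilon>) (simp_all add: R.P_add)
  qed
  show ?thesis
    unfolding \<gamma>_def [symmetric] P
  proof (intro conjI allI impI; elim conjE)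
    fix f \<epsilon> assume "f \<in> densities \<pi>" "0 < \<epsilon>" "\<epsilon> < (1 / 2 :: real)"
    from key [OF this order_refl order_refl]
    show "wmix_from T \<pi> f \<epsilon> \<le> 2 / (\<gamma> * \<epsilon>\<^sup>2) *
        (1 + sqrt (varent \<pi> (R.P (tmix_from T \<pi> f (1 - \<epsilon>)) *v f)))"
      by (simp add: wmix_from_def)
  next
    fix \<epsilon> :: real assume \<epsilon>: "0 < \<epsilon>" "\<epsilon> < 1 / 2"
    let ?t = "tmix T \<pi> (1 - \<epsilon>)"
    let ?V = "MAX x. varent \<pi> (R.P ?t *v dirac_density \<pi> x)"
    have "tmix_from T \<pi> (dirac_density \<pi> x) \<epsilon> \<le> 2 / (\<gamma> * \<epsilon>\<^sup>2) * (1 + sqrt ?V) + ?t" for x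
      by (intro key dirac_density_in_densities pos \<epsilon>) (auto simp: tmix_def intro!: Max_ge)
    then have "tmix T \<pi> \<epsilon> \<le> 2 / (\<gamma> * \<epsilon>\<^sup>2) * (1 + sqrt ?V) + ?t"
      unfolding tmix_def [of T \<pi> \<epsilon>] by (intro Max.boundedI) auto
    then show "wmix T \<pi> \<epsilon> \<le> 2 / (\<gamma> * \<epsilon>\<^sup>2) * (1 + sqrt ?V)"
      by (simp add: wmix_def)
  qed
qed

end
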